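(* Let $n\ge 3$ be an integer. For any $a,b\in\mathbb{R}$, the matrix $\mathrm{Circ}\big(a,a+b,\ldots,a+(n-1)b\big)\in\mathcal{M}_n(\mathbb{R})$ is invertible if and only if $\big(2a+(n-1)b\big)b\neq 0$, and in this case $$\mathrm{Circ}\big(a,a+b,\ldots,a+(n-1)b\big)^{-1}=\frac{2}{n^2\big(2a+(n-1)b\big)}\,J-\frac{1}{nb}\,\mathrm{Circ}(1,-1,0,\ldots,0).$$ In particular, for any $m\in\mathbb{Z}$ such that $2m+n\neq 1$, the matrix $\mathrm{Circ}(m,m+1,\ldots,m+n-1)$ is invertible and its inverse is $$\mathrm{Circ}(m,m+1,\ldots,m+n-1)^{-1}=\frac{2}{n^2(2m+n-1)}\,J-\frac{1}{n}\,\mathrm{Circ}(1,-1,0,\ldots,0).$$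
   Context: For $(a_1,\ldots,a_n)\in\mathbb{R}^n$, $\mathrm{Circ}(a_1,\ldots,a_n)\in\mathcal{M}_n(\mathbb{R})$ denotes the circulant matrix whose $(i,j)$ entry is $a_{1+((j-i)\bmod n)}$; its first row is $(a_1,\ldots,a_n)$ and each row is the cyclic right shift of the previous one. $J\in\mathcal{M}_n(\mathbb{R})$ is the matrix all of whose entries are $1$. In $\mathrm{Circ}(1,-1,0,\ldots,0)$ there are $n-2$ zeros. *)

theory Defs
  imports "Jordan_Normal_Form.Matrix"
begin

text \<open>Vectors and matrices of \<^theory>\<open>Jordan_Normal_Form.Matrix\<close> are indexed from 0, so the entry
  with 1-based indices \<open>(i,j)\<close>, namely \<open>a\<close> at position \<open>1 + ((j - i) mod n)\<close>, becomes
  \<open>v $ ((j - i) mod n)\<close>. The difference is taken in the integers, where \<open>mod n\<close> yields the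
  representative in \<open>{0..<n}\<close>.\<close>

definition Circ :: "'a vec \<Rightarrow> 'a mat" where
  "Circ v = mat (dim_vec v) (dim_vec v)
     (\<lambda>(i, j). v $ nat ((int j - int i) mod int (dim_vec v)))"

definition all_ones_mat :: "nat \<Rightarrow> real mat" where
  "all_ones_mat n = mat n n (\<lambda>_. 1)"

end

theory Submission
  imports Defs "Jordan_Normal_Form.Determinant"
begin

text \<open>Let \<open>A\<close> be the circulant matrix of the progression \<open>a, a + b, \<dots>, a + (n - 1) b\<close>, let
  \<open>D = Circ (1, -1, 0, \<dots>, 0)\<close>, and write \<open>t = 2 a + (n - 1) b\<close>. Two products decide everything.

  All rows of \<open>A\<close> have the sum \<open>n t / 2\<close>, so \<open>A J = (n t / 2) J\<close>. Multiplication by \<open>D\<close> on the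
  right takes cyclic differences along the rows, and the cyclic differences of an arithmetic
  progression are \<open>b\<close> except at the jump back from the last term to the first, where the difference
  is \<open>b - n b\<close>; in \<open>A\<close> this jump sits on the diagonal, so \<open>A D = b J - n b I\<close>.

  If \<open>t\<close> and \<open>b\<close> are nonzero, eliminating \<open>J\<close> between the two identities exhibits a right inverse of \<open>A\<close>,
  which for a square matrix over a field is also a left inverse. If \<open>t = 0\<close> then \<open>A J = 0\<close>, and if
  \<open>b = 0\<close> then \<open>A D = 0\<close>; as \<open>J\<close> and \<open>D\<close> are nonzero, \<open>A\<close> is not invertible in either case.\<close>

lemma Circ_carrier [simp]: "v \<in> carrier_vec n \<Longrightarrow> Circ v \<in> carrier_mat n n"
  by (auto simp: Circ_def)

lemma all_ones_mat_carrier [simp]: "all_ones_mat n \<in> carrier_mat n n"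
  by (simp add: all_ones_mat_def)

text \<open>With both indices below \<open>n\<close>, the residue of \<open>j - i\<close> needs at most one wrap-around. This form
  leaves only linear arithmetic on natural numbers for the later index computations.\<close>

lemma Circ_index:
  assumes "v \<in> carrier_vec n" "i < n" "j < n"
  shows "Circ v $$ (i, j) = v $ (if i \<le> j then j - i else j + n - i)"
proof -
  have "nat ((int j - int i) mod int n) = (if i \<le> j then j - i else j + n - i)"
  proof (cases "i \<le> j")
    case True
    then show ?thesis using assms by simp
  next
    case False
    have "(int j - int i) mod int n = (int j - int i + int n) mod int n" by simp
    also have "\<dots> = int j - int i + int n"
      using False assms by (intro mod_pos_pos_trivial) auto
    finally show ?thesis using False by simp
  qed
  then show ?thesis using assms by (auto simp: Circ_def)
qed

lemma Circ_row_sum: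
  fixes v :: "'a :: comm_monoid_add vec"
  assumes "v \<in> carrier_vec n" "i < n"
  shows "(\<Sum>k<n. Circ v $$ (i, k)) = (\<Sum>l<n. v $ l)"
  by (rule sum.reindex_bij_witness[where j = "\<lambda>k. if i \<le> k then k - i else k + n - i"
        and i = "\<lambda>l. if l + i < n then l + i else l + i - n"])
     (use assms in \<open>auto simp: Circ_index split: if_splits\<close>)

lemma mat_mult_index_sum:
  assumes "A \<in> carrier_mat n m" "B \<in> carrier_mat m p" "i < n" "j < p"
  shows "(A * B) $$ (i, j) = (\<Sum>k<m. A $$ (i, k) * B $$ (k, j))"
  using assms by (simp add: scalar_prod_def lessThan_atLeast0)

lemma Circ_mult_all_ones:
  fixes v :: "real vec"
  assumes v: "v \<in> carrier_vec n"
  shows "Circ v * all_ones_mat n = (\<Sum>l<n. v $ l) \<cdot>\<^sub>m all_ones_mat n"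
proof (rule eq_matI)
  fix i j assume "i < dim_row ((\<Sum>l<n. v $ l) \<cdot>\<^sub>m all_ones_mat n)"
    "j < dim_col ((\<Sum>l<n. v $ l) \<cdot>\<^sub>m all_ones_mat n)"
  then have ij: "i < n" "j < n" by (auto simp: all_ones_mat_def)
  have "(Circ v * all_ones_mat n) $$ (i, j) = (\<Sum>k<n. Circ v $$ (i, k))"
    using ij v by (subst mat_mult_index_sum[where n = n and m = n and p = n])
      (auto simp: all_ones_mat_def)
  then show "(Circ v * all_ones_mat n) $$ (i, j) = ((\<Sum>l<n. v $ l) \<cdot>\<^sub>m all_ones_mat n) $$ (i, j)"
    using ij v by (simp add: Circ_row_sum all_ones_mat_def)
qed (use v in \<open>auto simp: Circ_def all_ones_mat_def\<close>)

definition difference_circ :: "nat \<Rightarrow> 'a :: comm_ring_1 mat" where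
  "difference_circ n = Circ (vec_of_list (1 # -1 # replicate (n - 2) 0))"

lemma difference_circ_carrier [simp]:
  "n \<ge> 2 \<Longrightarrow> difference_circ n \<in> carrier_mat n n"
  unfolding difference_circ_def by (rule Circ_carrier) (auto intro!: carrier_vecI)

lemma difference_circ_index:
  assumes "n \<ge> 2" "k < n" "j < n"
  shows "difference_circ n $$ (k, j) =
    of_bool (k = j) - of_bool (k = (if j = 0 then n - 1 else j - 1))"
proof -
  have c: "vec_of_list (1 # -1 # replicate (n - 2) (0 :: 'a)) \<in> carrier_vec n"
    using assms by (auto intro!: carrier_vecI)
  define v where "v = vec_of_list (1 # -1 # replicate (n - 2) (0 :: 'a))"
  have v: "v $ l = of_bool (l = 0) - of_bool (l = 1)" if "l < n" for l
    unfolding v_def vec_of_list_index using that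
    by (cases l; cases "l - 1") (auto simp: nth_Cons')
  have "difference_circ n $$ (k, j) = v $ (if k \<le> j then j - k else j + n - k)"
    using assms unfolding difference_circ_def v_def by (intro Circ_index[OF c]) auto
  also have "\<dots> = of_bool (k = j) - of_bool (k = (if j = 0 then n - 1 else j - 1))"
    using assms by (subst v) auto
  finally show ?thesis .
qed

text \<open>Column \<open>j\<close> of \<open>difference_circ n\<close> has \<open>1\<close> in row \<open>j\<close> and \<open>-1\<close> in the cyclically preceding
  row, so right multiplication subtracts from each column the one cyclically before it.\<close>

lemma mult_difference_circ_index:
  fixes A :: "'a :: comm_ring_1 mat"
  assumes "n \<ge> 2" "A \<in> carrier_mat n n" "i < n" "j < n"
  shows "(A * difference_circ n) $$ (i, j) = A $$ (i, j) - A $$ (i, if j = 0 then n - 1 else j - 1)"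
proof -
  let ?p = "if j = 0 then n - 1 else j - 1"
  have "(A * difference_circ n) $$ (i, j) =
      (\<Sum>k<n. A $$ (i, k) * of_bool (k = j) - A $$ (i, k) * of_bool (k = ?p))"
    using assms
    by (subst mat_mult_index_sum[where n = n and m = n and p = n])
       (simp_all add: difference_circ_index right_diff_distrib del: if_split)
  also have "\<dots> = (\<Sum>k<n. if k = j then A $$ (i, k) else 0) - (\<Sum>k<n. if k = ?p then A $$ (i, k) else 0)"
    unfolding sum_subtractf by (intro arg_cong2[where f = minus] sum.cong) auto
  also have "\<dots> = A $$ (i, j) - A $$ (i, ?p)"
    using assms by (subst (1 2) sum.delta) auto
  finally show ?thesis .
qed

text \<open>Passing from column \<open>j - 1\<close> to column \<open>j\<close> moves one step along the progression, except
  when \<open>i = j\<close>: there it goes from the last term back to the first, a loss of \<open>(n - 1) b\<close>.\<close>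

lemma Circ_progression_mult_difference:
  fixes a b :: real
  assumes "n \<ge> 2"
  shows "Circ (vec n (\<lambda>k. a + real k * b)) * difference_circ n =
    b \<cdot>\<^sub>m all_ones_mat n - (real n * b) \<cdot>\<^sub>m 1\<^sub>m n" (is "?A * ?D = ?R")
proof (rule eq_matI)
  fix i j assume "i < dim_row ?R" "j < dim_col ?R"
  then have ij: "i < n" "j < n" by auto
  have "(?A * ?D) $$ (i, j) = ?A $$ (i, j) - ?A $$ (i, if j = 0 then n - 1 else j - 1)"
    using assms ij by (intro mult_difference_circ_index) auto
  also have "\<dots> = b - (if i = j then real n * b else 0)"
    using ij by (cases "j = 0"; cases "i \<le> j"; cases "i = j")
      (auto simp: Circ_index[where n = n] of_nat_diff algebra_simps)
  finally show "(?A * ?D) $$ (i, j) = ?R $$ (i, j)"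
    using ij by (simp add: all_ones_mat_def)
qed (use difference_circ_carrier[OF assms] in \<open>auto simp: Circ_def all_ones_mat_def\<close>)

lemma sum_progression:
  fixes a b :: real
  shows "(\<Sum>k<n. a + real k * b) = real n * (2 * a + (real n - 1) * b) / 2"
  by (induction n) (auto simp: field_simps)

lemma Circ_progression_mult_all_ones:
  fixes a b :: real
  shows "Circ (vec n (\<lambda>k. a + real k * b)) * all_ones_mat n =
    (real n * (2 * a + (real n - 1) * b) / 2) \<cdot>\<^sub>m all_ones_mat n"
  by (subst Circ_mult_all_ones) (simp_all add: sum_progression)

lemma Circ_progression_inverse:
  fixes a b :: real
  assumes n: "n \<ge> 2" and nz: "(2 * a + (real n - 1) * b) * b \<noteq> 0"
  defines "A \<equiv> Circ (vec n (\<lambda>k. a + real k * b))"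
    and "B \<equiv> (2 / ((real n)\<^sup>2 * (2 * a + (real n - 1) * b))) \<cdot>\<^sub>m all_ones_mat n
             - (1 / (real n * b)) \<cdot>\<^sub>m difference_circ n"
  shows "inverts_mat A B" "inverts_mat B A"
proof -
  let ?J = "all_ones_mat n" and ?D = "difference_circ n :: real mat"
  define t where "t = 2 * a + (real n - 1) * b"
  have tb: "t \<noteq> 0" "b \<noteq> 0" using nz by (auto simp: t_def)
  have A: "A \<in> carrier_mat n n" and B: "B \<in> carrier_mat n n" and D: "?D \<in> carrier_mat n n"
    using n by (auto simp: A_def B_def intro!: minus_carrier_mat)
  have "A * B = (2 / ((real n)\<^sup>2 * t)) \<cdot>\<^sub>m (A * ?J) - (1 / (real n * b)) \<cdot>\<^sub>m (A * ?D)"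
    unfolding B_def t_def
    using A D by (subst mult_minus_distrib_mat[OF A])
      (auto simp: mult_smult_distrib[OF A D] mult_smult_distrib[OF A all_ones_mat_carrier])
  also have "A * ?J = (real n * t / 2) \<cdot>\<^sub>m ?J"
    unfolding A_def t_def by (rule Circ_progression_mult_all_ones)
  also have "A * ?D = b \<cdot>\<^sub>m ?J - (real n * b) \<cdot>\<^sub>m 1\<^sub>m n"
    unfolding A_def by (rule Circ_progression_mult_difference[OF n])
  also have "(2 / ((real n)\<^sup>2 * t)) \<cdot>\<^sub>m ((real n * t / 2) \<cdot>\<^sub>m ?J)
      - (1 / (real n * b)) \<cdot>\<^sub>m (b \<cdot>\<^sub>m ?J - (real n * b) \<cdot>\<^sub>m 1\<^sub>m n) = 1\<^sub>m n"
    using tb n by (intro eq_matI) (auto simp: all_ones_mat_def field_simps power2_eq_square)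
  finally have AB: "A * B = 1\<^sub>m n" .
  moreover have "B * A = 1\<^sub>m n"
    by (rule mat_mult_left_right_inverse[OF A B AB])
  ultimately show "inverts_mat A B" "inverts_mat B A"
    using A B by (auto simp: inverts_mat_def)
qed

lemma invertible_mat_mult_eq_zero:
  fixes A :: "'a :: comm_ring_1 mat"
  assumes A: "A \<in> carrier_mat n n" and X: "X \<in> carrier_mat n m"
    and inv: "invertible_mat A" and AX: "A * X = 0\<^sub>m n m"
  shows "X = 0\<^sub>m n m"
proof -
  obtain B where B: "A * B = 1\<^sub>m n" "B * A = 1\<^sub>m (dim_row B)"
    using inv A by (auto simp: invertible_mat_def inverts_mat_def)
  have "dim_col (A * B) = n" "dim_col (B * A) = dim_row B"
    by (simp_all add: B)
  then have Bc: "B \<in> carrier_mat n n" using A by auto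
  have "X = (B * A) * X" using B Bc X by simp
  also have "\<dots> = 0\<^sub>m n m" using A Bc X by (simp add: AX)
  finally show ?thesis .
qed

lemma Circ_progression_not_invertible:
  fixes a b :: real
  assumes n: "n \<ge> 2" and z: "(2 * a + (real n - 1) * b) * b = 0"
  shows "\<not> invertible_mat (Circ (vec n (\<lambda>k. a + real k * b)))" (is "\<not> invertible_mat ?A")
proof
  let ?J = "all_ones_mat n" and ?D = "difference_circ n :: real mat"
  assume inv: "invertible_mat ?A"
  have A: "?A \<in> carrier_mat n n" and D: "?D \<in> carrier_mat n n" using n by auto
  have "?J $$ (0, 0) = 1" using n by (simp add: all_ones_mat_def)
  moreover have "?D $$ (0, 0) = 1" using n by (simp add: difference_circ_index)
  ultimately have nz: "?J \<noteq> 0\<^sub>m n n" "?D \<noteq> 0\<^sub>m n n" using n by auto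
  from z consider "2 * a + (real n - 1) * b = 0" | "b = 0" by auto
  then show False
  proof cases
    case 1
    then have "?A * ?J = 0\<^sub>m n n"
      unfolding Circ_progression_mult_all_ones by (intro eq_matI) (auto simp: all_ones_mat_def)
    with nz show False using invertible_mat_mult_eq_zero[OF A _ inv] by auto
  next
    case 2
    then have "?A * ?D = 0\<^sub>m n n"
      unfolding Circ_progression_mult_difference[OF n]
      by (intro eq_matI) (auto simp: all_ones_mat_def)
    with nz show False using invertible_mat_mult_eq_zero[OF A D inv] by auto
  qed
qed

lemma Circ_progression_invertible_iff:
  fixes a b :: real
  assumes "n \<ge> 2"
  shows "invertible_mat (Circ (vec n (\<lambda>k. a + real k * b)))
    \<longleftrightarrow> (2 * a + (real n - 1) * b) * b \<noteq> 0"
proof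
  assume "invertible_mat (Circ (vec n (\<lambda>k. a + real k * b)))"
  then show "(2 * a + (real n - 1) * b) * b \<noteq> 0"
    using Circ_progression_not_invertible[OF assms] by blast
next
  assume nz: "(2 * a + (real n - 1) * b) * b \<noteq> 0"
  have "square_mat (Circ (vec n (\<lambda>k. a + real k * b)))" by (simp add: Circ_def)
  with Circ_progression_inverse[OF assms nz]
  show "invertible_mat (Circ (vec n (\<lambda>k. a + real k * b)))"
    unfolding invertible_mat_def by blast
qed

theorem corollary2p4:
  fixes n :: nat
  assumes "n \<ge> 3"
  shows
    "(\<forall>a b :: real.
        (invertible_mat (Circ (vec n (\<lambda>k. a + real k * b)))
           \<longleftrightarrow> (2 * a + (real n - 1) * b) * b \<noteq> 0) \<and>
        ((2 * a + (real n - 1) * b) * b \<noteq> 0 \<longrightarrow>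
           (let A = Circ (vec n (\<lambda>k. a + real k * b));
                B = (2 / ((real n)\<^sup>2 * (2 * a + (real n - 1) * b))) \<cdot>\<^sub>m all_ones_mat n
                    - (1 / (real n * b)) \<cdot>\<^sub>m Circ (vec_of_list (1 # -1 # replicate (n - 2) 0))
            in inverts_mat A B \<and> inverts_mat B A))) \<and>
     (\<forall>m :: int. 2 * m + int n \<noteq> 1 \<longrightarrow>
        (let A = Circ (vec n (\<lambda>k. real_of_int (m + int k)));
             B = (2 / ((real n)\<^sup>2 * (2 * real_of_int m + real n - 1))) \<cdot>\<^sub>m all_ones_mat n
                 - (1 / real n) \<cdot>\<^sub>m Circ (vec_of_list (1 # -1 # replicate (n - 2) 0))
         in invertible_mat A \<and> inverts_mat A B \<and> inverts_mat B A))"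
proof (intro conjI allI impI)
  have n: "n \<ge> 2" using assms by simp
  fix a b :: real
  show "invertible_mat (Circ (vec n (\<lambda>k. a + real k * b)))
      \<longleftrightarrow> (2 * a + (real n - 1) * b) * b \<noteq> 0"
    by (rule Circ_progression_invertible_iff[OF n])
  assume "(2 * a + (real n - 1) * b) * b \<noteq> 0"
  from Circ_progression_inverse[OF n this]
  show "let A = Circ (vec n (\<lambda>k. a + real k * b));
            B = (2 / ((real n)\<^sup>2 * (2 * a + (real n - 1) * b))) \<cdot>\<^sub>m all_ones_mat n
                - (1 / (real n * b)) \<cdot>\<^sub>m Circ (vec_of_list (1 # -1 # replicate (n - 2) 0))
        in inverts_mat A B \<and> inverts_mat B A"
    by (simp add: Let_def difference_circ_def)
next
  have n: "n \<ge> 2" using assms by simp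
  \<comment> \<open>The integer case is the progression with \<open>a = m\<close> and \<open>b = 1\<close>, where the criterion reads
    \<open>2 m + n - 1 \<noteq> 0\<close>.\<close>
  fix m :: int assume "2 * m + int n \<noteq> 1"
  then have "real_of_int (2 * m + int n) \<noteq> real_of_int 1" unfolding of_int_eq_iff .
  then have nz: "(2 * real_of_int m + (real n - 1) * 1) * 1 \<noteq> 0" by simp
  show "let A = Circ (vec n (\<lambda>k. real_of_int (m + int k)));
            B = (2 / ((real n)\<^sup>2 * (2 * real_of_int m + real n - 1))) \<cdot>\<^sub>m all_ones_mat n
                - (1 / real n) \<cdot>\<^sub>m Circ (vec_of_list (1 # -1 # replicate (n - 2) 0))
        in invertible_mat A \<and> inverts_mat A B \<and> inverts_mat B A"
    using Circ_progression_inverse[OF n nz] Circ_progression_invertible_iff[OF n, of "real_of_int m" 1] nz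
    by (simp add: Let_def add_diff_eq difference_circ_def)
qed

end
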